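(* Let $B$ be a barrier on an infinite set $X\subseteq\mathbb{N}$. For every function $f:B\to\mathbb{N}$ there exists a barrier $B'\subseteq B$ such that the image of the restriction of $f$ to $B'$ is different from $\mathbb{N}$.
   Context: $\mathbb{N}$ is the set of natural numbers (including $0$). Subsets of $\mathbb{N}$ are identified with their strictly increasing enumerations; $s\sqsubset Y$ means that $s$ is a proper initial segment of $Y$ as a sequence; $\subset$ is strict set inclusion. A set $B$ of finite subsets of $\mathbb{N}$ is a barrier on an infinite set $X\subseteq\mathbb{N}$ if: (1) $\bigcup B=X$; (2) for all $s,t\in B$, $s\not\subset t$; (3) for every infinite $Y\subseteq X$ there is $s\in B$ with $s\sqsubset Y$. The set $b(B)=\bigcup B$ is called the base of $B$. A family $B'$ is called a barrier if it is a barrier on its base $b(B')$ (in particular $b(B')$ is infinite). *)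

theory Defs
  imports "HOL-Library.Infinite_Set"
begin

(* A set of naturals is read as its strictly increasing enumeration, given by enumerate.
   For a finite set the values of enumerate at indices below the cardinality are the
   intended ones; those at larger indices are junk and are never used here. *)
definition proper_initial_segment :: "nat set \<Rightarrow> nat set \<Rightarrow> bool" where
  "proper_initial_segment s Y \<longleftrightarrow>
     finite s \<and> (infinite Y \<or> card s < card Y) \<and>
     (\<forall>i < card s. enumerate s i = enumerate Y i)"

definition barrier_on :: "nat set set \<Rightarrow> nat set \<Rightarrow> bool" where
  "barrier_on B X \<longleftrightarrow>
     infinite X \<and> (\<forall>s\<in>B. finite s) \<and>
     \<Union>B = X \<and>
     (\<forall>s\<in>B. \<forall>t\<in>B. \<not> s \<subset> t) \<and>
     (\<forall>Y. infinite Y \<and> Y \<subseteq> X \<longrightarrow> (\<exists>s\<in>B. proper_initial_segment s Y))"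

definition base :: "nat set set \<Rightarrow> nat set" where
  "base B = \<Union>B"

definition barrier :: "nat set set \<Rightarrow> bool" where
  "barrier B \<longleftrightarrow> barrier_on B (base B)"

end

theory Submission
  imports Defs
begin

text \<open>
  By the Nash-Williams partition theorem, an infinite \<open>Y \<subseteq> X\<close> can be found such that \<open>f\<close> is
  either constantly \<open>0\<close> or never \<open>0\<close> on the members of \<open>B\<close> contained in \<open>Y\<close>, and these members
  form a barrier on \<open>Y\<close>. The set \<open>Y\<close> comes from Galvin's lemma, proved by combinatorial forcing:
  an infinite set \<open>A\<close> accepts a finite set \<open>s\<close> if every infinite end-extension of \<open>s\<close> by elements
  of \<open>A\<close> has an initial segment in \<open>P\<close>, and it rejects \<open>s\<close> if none of its infinite subsets
  accepts \<open>s\<close>.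
\<close>

section \<open>Initial segments as truncations\<close>

lemma enumerate_Int_lessThan:
  fixes S :: "nat set"
  assumes "n < card (S \<inter> {..<m})"
  shows "enumerate (S \<inter> {..<m}) n = enumerate S n"
  using assms
proof (induction n arbitrary: S)
  \<comment> \<open>Truncation keeps the least element as long as anything survives, so deleting
    that element commutes with truncating. This drives both cases of the induction.\<close>
  have least: "(LEAST k. k \<in> S \<inter> {..<m}) = (LEAST k. k \<in> S)" if ne: "S \<inter> {..<m} \<noteq> {}" for S
  proof -
    obtain x where x: "x \<in> S" "x < m" using ne by blast
    then have "(LEAST k. k \<in> S) \<in> S \<inter> {..<m}"
      using LeastI[of "\<lambda>k. k \<in> S" x] Least_le[of "\<lambda>k. k \<in> S" x] by auto
    then show ?thesis
      by (intro Least_equality) (auto intro: Least_le)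
  qed
  {
    case 0
    then have "S \<inter> {..<m} \<noteq> {}" by auto
    from least[OF this] show ?case by (simp only: enumerate_0)
  next
    case (Suc n)
    let ?l = "LEAST k. k \<in> S"
    have ne: "S \<inter> {..<m} \<noteq> {}" using Suc.prems by auto
    have eq: "S \<inter> {..<m} - {?l} = (S - {?l}) \<inter> {..<m}" by auto
    have "?l \<in> S \<inter> {..<m}"
      using LeastI_ex[of "\<lambda>k. k \<in> S \<inter> {..<m}"] ne unfolding least[OF ne] by blast
    then have "n < card ((S - {?l}) \<inter> {..<m})"
      using Suc.prems unfolding eq[symmetric] by (subst card_Diff_singleton) auto
    then show ?case
      using Suc.IH by (simp only: enumerate_Suc least[OF ne] eq)
  }
qed

text \<open>From here on, initial segments are handled as truncations
  \<open>Y \<inter> {..<m}\<close>, which avoids any further reasoning about enumerations.\<close>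

lemma proper_initial_segment_iff:
  assumes "infinite Y"
  shows "proper_initial_segment s Y \<longleftrightarrow> (\<exists>m. s = Y \<inter> {..<m})"
proof
  assume L: "proper_initial_segment s Y"
  then have "s = enumerate s ` {..<card s}"
    using finite_bij_enumerate[of s] by (auto simp: proper_initial_segment_def bij_betw_def)
  also have "\<dots> = enumerate Y ` {..<card s}"
    using L by (auto simp: proper_initial_segment_def)
  \<comment> \<open>The cut is made at the first element of \<open>Y\<close> after the segment;
    \<open>{..<m}\<close> excludes its bound.\<close>
  also have "\<dots> = Y \<inter> {..<enumerate Y (card s)}"
  proof (intro equalityI subsetI)
    fix y assume y: "y \<in> Y \<inter> {..<enumerate Y (card s)}"
    then obtain n where "enumerate Y n = y" using enumerate_Ex[OF assms] by blast
    then show "y \<in> enumerate Y ` {..<card s}" using y assms by auto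
  qed (use assms enumerate_in_set in auto)
  finally show "\<exists>m. s = Y \<inter> {..<m}" ..
next
  assume "\<exists>m. s = Y \<inter> {..<m}"
  then show "proper_initial_segment s Y"
    using assms by (auto simp: proper_initial_segment_def enumerate_Int_lessThan)
qed

section \<open>Tails and end-extensions\<close>

definition tail :: "nat set \<Rightarrow> nat set \<Rightarrow> nat set" where
  "tail s Z = {z \<in> Z. \<forall>x\<in>s. x < z}"

lemma tail_subset: "tail s Z \<subseteq> Z"
  by (auto simp: tail_def)

lemma tail_mono: "Z \<subseteq> Y \<Longrightarrow> tail s Z \<subseteq> tail s Y"
  by (auto simp: tail_def)

lemma tail_tail [simp]: "tail s (tail s Z) = tail s Z"
  by (auto simp: tail_def)

lemma tail_empty [simp]: "tail {} Z = Z"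
  by (auto simp: tail_def)

lemma infinite_tail:
  assumes "finite s" "infinite Z"
  shows "infinite (tail s Z)"
proof
  assume "finite (tail s Z)"
  moreover have "Z \<subseteq> tail s Z \<union> (\<Union>x\<in>s. {..x})"
    by (auto simp: tail_def not_less)
  ultimately show False
    using assms by (meson finite_UN finite_Un finite_atMost finite_subset)
qed

text \<open>Makes \<open>s \<union> tail s Z\<close> an end-extension of \<open>s\<close>: cut just
  after \<open>Max s\<close>, or at 0 if \<open>s\<close> is empty and has no maximum.\<close>

lemma initial_segment_Un_tail:
  assumes "finite s"
  shows "\<exists>m. (s \<union> tail s Z) \<inter> {..<m} = s"
proof (cases "s = {}")
  case True
  then show ?thesis by (intro exI[of _ 0]) auto
next
  case False
  have "(s \<union> tail s Z) \<inter> {..<Suc (Max s)} = s"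
    using Max_in[OF assms False] Max_ge[OF assms] by (fastforce simp: tail_def less_Suc_eq_le)
  then show ?thesis ..
qed

section \<open>Fusion of infinite sets\<close>

lemma diagonal_finite:
  assumes ex: "\<And>s A. s \<in> S \<Longrightarrow> infinite A \<Longrightarrow> A \<subseteq> X \<Longrightarrow> \<exists>C\<subseteq>A. infinite C \<and> Q s C"
    and anti: "\<And>s C D. Q s C \<Longrightarrow> D \<subseteq> C \<Longrightarrow> infinite D \<Longrightarrow> Q s D"
    and "finite S" "infinite A" "A \<subseteq> X"
  shows "\<exists>C\<subseteq>A. infinite C \<and> (\<forall>s\<in>S. Q s C)"
  using \<open>finite S\<close> ex
proof (induction S rule: finite_induct)
  case empty
  then show ?case using \<open>infinite A\<close> by auto
next
  case (insert s S)
  then obtain C where C: "C \<subseteq> A" "infinite C" "\<forall>s\<in>S. Q s C" by auto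
  then obtain D where "D \<subseteq> C" "infinite D" "Q s D"
    using insert.prems[of s C] \<open>A \<subseteq> X\<close> by auto
  then show ?case using C anti by (intro exI[of _ D]) auto
qed

text \<open>Elements of \<open>Y\<close> are chosen one at a time from a shrinking sequence of
  infinite reservoirs. The stage that chooses \<open>a\<close> settles all finite sets with maximum
  \<open>a\<close>, and all later elements of \<open>Y\<close> come from its reservoir, so
  \<open>anti\<close> carries \<open>Q\<close> over to the tail.\<close>

lemma diagonal:
  fixes X :: "nat set"
  assumes "infinite X"
    and ex: "\<And>s A. finite s \<Longrightarrow> s \<subseteq> X \<Longrightarrow> infinite A \<Longrightarrow> A \<subseteq> X \<Longrightarrow> \<exists>C\<subseteq>A. infinite C \<and> Q s C"
    and anti: "\<And>s C D. Q s C \<Longrightarrow> D \<subseteq> C \<Longrightarrow> infinite D \<Longrightarrow> Q s D"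
  shows "\<exists>Y\<subseteq>X. infinite Y \<and> (\<forall>s. finite s \<longrightarrow> s \<subseteq> Y \<longrightarrow> Q s (tail s Y))"
proof -
  \<comment> \<open>The empty set has no maximum and hence no stage of its own, so it is settled in
    advance.\<close>
  obtain D where D: "D \<subseteq> X" "infinite D" "Q {} D"
    using ex[of "{}" X] \<open>infinite X\<close> by auto
  \<comment> \<open>A state consists of the chosen element and the reservoir beyond it. All subsets
    of \<open>D\<close> up to that element are settled, whether or not their elements were chosen;
    there are only finitely many.\<close>
  define good where "good p \<longleftrightarrow> fst p \<in> D \<and> snd p \<subseteq> D \<inter> {fst p<..} \<and> infinite (snd p) \<and>
    (\<forall>s\<subseteq>{..fst p} \<inter> D. Q s (snd p))" for p :: "nat \<times> nat set"
  have step: "\<exists>q. good q \<and> fst q \<in> A \<and> snd q \<subseteq> A" if A: "infinite A" "A \<subseteq> D" for A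
  proof -
    obtain a where a: "a \<in> A" using A infinite_imp_nonempty by blast
    have "infinite (A \<inter> {a<..})"
      using infinite_tail[of "{a}" A] A by (simp add: tail_def Collect_conj_eq greaterThan_def)
    moreover have "\<exists>C\<subseteq>A'. infinite C \<and> Q s C"
      if "s \<in> Pow ({..a} \<inter> D)" "infinite A'" "A' \<subseteq> X" for s A'
      using that D finite_subset[of s "{..a}"] by (intro ex) auto
    moreover have "finite (Pow ({..a} \<inter> D))" "A \<inter> {a<..} \<subseteq> X" using A D by auto
    ultimately have "\<exists>C\<subseteq>A \<inter> {a<..}. infinite C \<and> (\<forall>s\<in>Pow ({..a} \<inter> D). Q s C)"
      using anti by (intro diagonal_finite)
    then obtain C where "C \<subseteq> A \<inter> {a<..}" "infinite C" "\<forall>s\<in>Pow ({..a} \<inter> D). Q s C"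
      by blast
    then have "good (a, C)" "C \<subseteq> A" using a A by (auto simp: good_def)
    then show ?thesis using a by (intro exI[of _ "(a, C)"]) auto
  qed
  have "\<exists>g. \<forall>n. good (g n) \<and> (fst (g (Suc n)) \<in> snd (g n) \<and> snd (g (Suc n)) \<subseteq> snd (g n))"
  proof (rule dependent_nat_choice)
    show "\<exists>p. good p" using step[of D] D by auto
    show "\<exists>q. good q \<and> fst q \<in> snd p \<and> snd q \<subseteq> snd p" if "good p" for p :: "nat \<times> nat set"
      using that step[of "snd p"] by (auto simp: good_def)
  qed
  then obtain g where good: "\<And>n. good (g n)"
    and gf: "\<And>n. fst (g (Suc n)) \<in> snd (g n)" and gs: "\<And>n. snd (g (Suc n)) \<subseteq> snd (g n)"
    by blast
  have dec: "snd (g n) \<subseteq> snd (g m)" if "m \<le> n" for m n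
    using lift_Suc_antimono_le[of "\<lambda>n. snd (g n)", OF gs that] .
  have mem: "fst (g n) \<in> snd (g m)" if mn: "m < n" for m n
  proof -
    obtain k where "n = Suc k" "m \<le> k" using mn by (cases n) auto
    then show ?thesis using gf dec by blast
  qed
  have sm: "strict_mono (\<lambda>n. fst (g n))"
    using gf good by (intro strict_mono_Suc_iff[THEN iffD2]) (force simp: good_def)
  define Y where "Y = range (\<lambda>n. fst (g n))"
  have Y: "Y \<subseteq> D" "infinite Y"
  proof -
    show "Y \<subseteq> D" using good by (auto simp: Y_def good_def)
    show "infinite Y"
      unfolding Y_def by (rule range_inj_infinite[OF strict_mono_imp_inj_on[OF sm]])
  qed
  have "Q s (tail s Y)" if s: "finite s" "s \<subseteq> Y" for s
  proof (cases "s = {}")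
    case True
    then show ?thesis using D Y anti by auto
  next
    case False
    then have "Max s \<in> Y" using s Max_in by blast
    then obtain n where n: "Max s = fst (g n)" by (auto simp: Y_def)
    \<comment> \<open>Elements of \<open>Y\<close> above \<open>Max s\<close> were chosen after
      stage \<open>n\<close>, hence from its reservoir.\<close>
    have "tail s Y \<subseteq> snd (g n)"
    proof
      fix z assume z: "z \<in> tail s Y"
      then obtain k where k: "z = fst (g k)" by (auto simp: tail_def Y_def)
      have "Max s < z" using z Max_in[OF s(1) False] by (auto simp: tail_def)
      then have "n < k" using strict_mono_less[OF sm] n k by simp
      then show "z \<in> snd (g n)" using mem k by simp
    qed
    moreover have "s \<subseteq> {..fst (g n)} \<inter> D"
      using s Y Max_ge[OF s(1)] n by auto
    ultimately show ?thesis
      using good[of n] anti[OF _ _ infinite_tail[OF s(1) Y(2)]] unfolding good_def by metis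
  qed
  then show ?thesis using Y D by (intro exI[of _ Y]) auto
qed

section \<open>Combinatorial forcing and partition theorems\<close>

definition accepts :: "nat set set \<Rightarrow> nat set \<Rightarrow> nat set \<Rightarrow> bool" where
  "accepts P A s \<longleftrightarrow>
     (\<forall>Z\<subseteq>A. infinite Z \<longrightarrow> (\<exists>m. (s \<union> tail s Z) \<inter> {..<m} \<in> P))"

definition rejects :: "nat set set \<Rightarrow> nat set \<Rightarrow> nat set \<Rightarrow> bool" where
  "rejects P A s \<longleftrightarrow> (\<forall>C\<subseteq>A. infinite C \<longrightarrow> \<not> accepts P C s)"

lemma accepts_subset: "accepts P A s \<Longrightarrow> C \<subseteq> A \<Longrightarrow> accepts P C s"
  by (auto simp: accepts_def)

lemma rejects_subset: "rejects P A s \<Longrightarrow> C \<subseteq> A \<Longrightarrow> rejects P C s"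
  by (auto simp: rejects_def)

text \<open>Acceptance looks at \<open>Z\<close> only through \<open>tail s Z\<close>, which is
  again infinite. This and its analogue for rejection remove the tail from the conclusion of
  \<open>diagonal\<close>.\<close>

lemma accepts_tail_iff:
  assumes "finite s"
  shows "accepts P (tail s A) s \<longleftrightarrow> accepts P A s"
proof
  assume L: "accepts P (tail s A) s"
  have "\<exists>m. (s \<union> tail s Z) \<inter> {..<m} \<in> P" if "Z \<subseteq> A" "infinite Z" for Z
    using L infinite_tail[OF assms that(2)] tail_mono[OF that(1), of s]
    unfolding accepts_def by (metis tail_tail)
  then show "accepts P A s" by (auto simp: accepts_def)
qed (use accepts_subset tail_subset in blast)

lemma rejects_tail_iff:
  assumes "finite s"
  shows "rejects P (tail s A) s \<longleftrightarrow> rejects P A s"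
proof
  assume L: "rejects P (tail s A) s"
  have "\<not> accepts P C s" if "C \<subseteq> A" "infinite C" for C
    using L infinite_tail[OF assms that(2)] tail_mono[OF that(1), of s] accepts_tail_iff[OF assms]
    unfolding rejects_def by blast
  then show "rejects P A s" by (auto simp: rejects_def)
qed (use rejects_subset tail_subset in blast)

text \<open>A set that does not reject \<open>s\<close> has, by definition, an infinite subset
  accepting it. Both properties pass to subsets, so fusion decides all finite sets at once.\<close>

lemma deciding_subset:
  fixes X :: "nat set"
  assumes "infinite X"
  shows "\<exists>Y\<subseteq>X. infinite Y \<and> (\<forall>s. finite s \<longrightarrow> s \<subseteq> Y \<longrightarrow> accepts P Y s \<or> rejects P Y s)"
proof -
  have "\<exists>Y\<subseteq>X. infinite Y \<and>
      (\<forall>s. finite s \<longrightarrow> s \<subseteq> Y \<longrightarrow> accepts P (tail s Y) s \<or> rejects P (tail s Y) s)"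
  proof (rule diagonal[OF assms])
    show "\<exists>C\<subseteq>A. infinite C \<and> (accepts P C s \<or> rejects P C s)" if "infinite A" for s A
      using that unfolding rejects_def by blast
  qed (use accepts_subset rejects_subset in blast)
  then show ?thesis by (metis accepts_tail_iff rejects_tail_iff)
qed

text \<open>If there were infinitely many such \<open>a\<close>, the set of all of them would accept
  \<open>s\<close>, since each of its infinite subsets begins with some \<open>a\<close> for which
  \<open>insert a s\<close> is accepted.\<close>

lemma finite_accepted_extensions:
  assumes "finite s" "rejects P A s"
  shows "finite {a \<in> tail s A. accepts P A (insert a s)}"
proof (rule ccontr)
  let ?C = "{a \<in> tail s A. accepts P A (insert a s)}"
  assume inf: "infinite ?C"
  have "\<exists>m. (s \<union> tail s Z) \<inter> {..<m} \<in> P" if Z: "Z \<subseteq> ?C" "infinite Z" for Z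
  proof -
    have tZ: "tail s Z = Z" using Z(1) by (auto simp: tail_def)
    \<comment> \<open>With \<open>a\<close> least in \<open>Z\<close>, the end-extensions of
      \<open>s\<close> and of \<open>insert a s\<close> by \<open>Z\<close> are the same
      set.\<close>
    define a where "a = (LEAST a. a \<in> Z)"
    have a: "a \<in> Z" and le: "\<And>z. z \<in> Z \<Longrightarrow> a \<le> z"
      using Z(2) infinite_imp_nonempty[of Z] by (auto simp: a_def intro: LeastI Least_le)
    have "tail (insert a s) Z = Z - {a}"
      using tZ le by (auto simp: tail_def order.strict_iff_order)
    then have "insert a s \<union> tail (insert a s) Z = s \<union> tail s Z"
      using tZ a by auto
    moreover have "accepts P A (insert a s)" "Z \<subseteq> A"
      using a Z(1) by (auto simp: tail_def)
    ultimately show ?thesis using Z(2) unfolding accepts_def by metis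
  qed
  then have "accepts P ?C s" by (auto simp: accepts_def)
  moreover have "?C \<subseteq> A" by (auto simp: tail_def)
  ultimately show False using assms(2) inf by (auto simp: rejects_def)
qed

text \<open>If \<open>{}\<close> is accepted, the first alternative holds. Otherwise a deciding set
  is thinned until rejection spreads from \<open>{}\<close> to all its finite subsets, while a
  member of \<open>P\<close> can never be rejected.\<close>

lemma galvin:
  fixes X :: "nat set"
  assumes "infinite X"
  shows "\<exists>Y\<subseteq>X. infinite Y \<and>
    ((\<forall>Z\<subseteq>Y. infinite Z \<longrightarrow> (\<exists>m. Z \<inter> {..<m} \<in> P)) \<or> (\<forall>s\<subseteq>Y. finite s \<longrightarrow> s \<notin> P))"
proof -
  obtain A where A: "A \<subseteq> X" "infinite A"
    and dec: "\<And>s. finite s \<Longrightarrow> s \<subseteq> A \<Longrightarrow> accepts P A s \<or> rejects P A s"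
    using deciding_subset[OF assms] by metis
  show ?thesis
  proof (cases "accepts P A {}")
    case True
    then show ?thesis using A by (intro exI[of _ A]) (auto simp: accepts_def)
  next
    case False
    then have rej: "rejects P A {}" using dec by auto
    \<comment> \<open>The inner \<open>tail s\<close> restricts to end-extensions, the only ones
      under control; the outer one is the form that \<open>diagonal\<close> delivers.\<close>
    have "\<exists>Y\<subseteq>A. infinite Y \<and> (\<forall>s. finite s \<longrightarrow> s \<subseteq> Y \<longrightarrow> rejects P A s \<longrightarrow>
        (\<forall>a\<in>tail s (tail s Y). rejects P A (insert a s)))"
    proof (rule diagonal[OF A(2)])
      fix s C assume s: "finite s" "s \<subseteq> A" and C: "infinite C" "C \<subseteq> A"
      show "\<exists>D\<subseteq>C. infinite D \<and> (rejects P A s \<longrightarrow> (\<forall>a\<in>tail s D. rejects P A (insert a s)))"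
      proof (cases "rejects P A s")
        case True
        \<comment> \<open>Only finitely many points are lost, and as \<open>A\<close> decides every
          finite subset, what is not accepted is rejected.\<close>
        let ?D = "C - {a \<in> tail s A. accepts P A (insert a s)}"
        have "infinite ?D"
          using finite_accepted_extensions[OF s(1) True] C(1) by simp
        moreover have "rejects P A (insert a s)" if "a \<in> tail s ?D" for a
          using that dec[of "insert a s"] s C by (auto simp: tail_def)
        ultimately show ?thesis by (intro exI[of _ ?D]) auto
      qed (use C in auto)
    next
      fix s C D
      assume "rejects P A s \<longrightarrow> (\<forall>a\<in>tail s C. rejects P A (insert a s))" "D \<subseteq> C"
      then show "rejects P A s \<longrightarrow> (\<forall>a\<in>tail s D. rejects P A (insert a s))"
        using tail_mono[of D C s] by (simp add: subset_iff)
    qed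
    then obtain Y where Y: "Y \<subseteq> A" "infinite Y"
      and ext: "\<And>s a. finite s \<Longrightarrow> s \<subseteq> Y \<Longrightarrow> rejects P A s \<Longrightarrow> a \<in> tail s Y
        \<Longrightarrow> rejects P A (insert a s)"
      unfolding tail_tail by auto
    \<comment> \<open>Each finite subset of \<open>Y\<close> is built up from \<open>{}\<close> in
      increasing order, so \<open>ext\<close> applies at every step.\<close>
    have "rejects P A s" if "finite s" "s \<subseteq> Y" for s
      using that
    proof (induction s rule: finite_linorder_max_induct)
      case (insert a s)
      then show ?case by (intro ext) (auto simp: tail_def)
    qed (use rej in auto)
    \<comment> \<open>A member of \<open>P\<close> is itself an initial segment of each of its
      end-extensions.\<close>
    moreover have "accepts P A s" if "s \<in> P" "finite s" for s
      using initial_segment_Un_tail[OF that(2)] that(1) unfolding accepts_def by metis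
    ultimately have "\<forall>s\<subseteq>Y. finite s \<longrightarrow> s \<notin> P"
      using A(2) unfolding rejects_def by blast
    then show ?thesis using Y A by (intro exI[of _ Y]) auto
  qed
qed

text \<open>Galvin's lemma for \<open>P\<close> nearly suffices. In its first alternative, an
  end-extension of \<open>s\<close> within \<open>Y\<close> has an initial segment in
  \<open>P\<close>; two initial segments of one set are comparable, so the antichain condition
  identifies this one with \<open>s\<close>.\<close>

lemma nash_williams:
  fixes B P :: "nat set set"
  assumes "infinite X" "P \<subseteq> B"
    and fin: "\<And>s. s \<in> B \<Longrightarrow> finite s"
    and antichain: "\<And>s t. s \<in> B \<Longrightarrow> t \<in> B \<Longrightarrow> \<not> s \<subset> t"
  shows "\<exists>Y\<subseteq>X. infinite Y \<and> ((\<forall>s\<in>B. s \<subseteq> Y \<longrightarrow> s \<in> P) \<or> (\<forall>s\<in>B. s \<subseteq> Y \<longrightarrow> s \<notin> P))"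
proof -
  obtain Y where Y: "Y \<subseteq> X" "infinite Y"
    and alt: "(\<forall>Z\<subseteq>Y. infinite Z \<longrightarrow> (\<exists>m. Z \<inter> {..<m} \<in> P)) \<or> (\<forall>s\<subseteq>Y. finite s \<longrightarrow> s \<notin> P)"
    using galvin[OF \<open>infinite X\<close>] by metis
  from alt show ?thesis
  proof
    assume hit: "\<forall>Z\<subseteq>Y. infinite Z \<longrightarrow> (\<exists>m. Z \<inter> {..<m} \<in> P)"
    have "s \<in> P" if s: "s \<in> B" "s \<subseteq> Y" for s
    proof -
      let ?Z = "s \<union> tail s Y"
      have "?Z \<subseteq> Y" "infinite ?Z"
        using s infinite_tail[OF fin[OF s(1)] Y(2)] tail_subset by auto
      then obtain m where m: "?Z \<inter> {..<m} \<in> P" using hit by blast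
      obtain k where k: "?Z \<inter> {..<k} = s" using initial_segment_Un_tail[OF fin[OF s(1)]] by blast
      have "?Z \<inter> {..<m} \<subseteq> ?Z \<inter> {..<k} \<or> ?Z \<inter> {..<k} \<subseteq> ?Z \<inter> {..<m}"
        by (cases "m \<le> k") auto
      then have "?Z \<inter> {..<m} \<subseteq> s \<or> s \<subseteq> ?Z \<inter> {..<m}" unfolding k .
      moreover have "?Z \<inter> {..<m} \<in> B" using m \<open>P \<subseteq> B\<close> by blast
      ultimately have "?Z \<inter> {..<m} = s" using antichain s(1) by blast
      then show ?thesis using m by simp
    qed
    then show ?thesis using Y by blast
  next
    assume "\<forall>s\<subseteq>Y. finite s \<longrightarrow> s \<notin> P"
    then have "\<forall>s\<in>B. s \<subseteq> Y \<longrightarrow> s \<notin> P" using fin by simp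
    then show ?thesis using Y by (intro exI[of _ Y]) simp
  qed
qed

section \<open>Restricting a barrier\<close>

lemma barrier_on_restrict:
  assumes B: "barrier_on B X" and Y: "Y \<subseteq> X" "infinite Y"
  shows "barrier_on {s \<in> B. s \<subseteq> Y} Y"
proof -
  \<comment> \<open>An initial segment of \<open>Z\<close> is a subset of \<open>Z\<close>, so the
    member of \<open>B\<close> found for \<open>Z\<close> survives the restriction to
    \<open>Y\<close>.\<close>
  have seg: "\<exists>s\<in>B. s \<subseteq> Z \<and> proper_initial_segment s Z" if Z: "infinite Z" "Z \<subseteq> Y" for Z
  proof -
    have "Z \<subseteq> X" using Z(2) Y(1) by (rule subset_trans)
    moreover have "\<forall>Y. infinite Y \<and> Y \<subseteq> X \<longrightarrow> (\<exists>s\<in>B. proper_initial_segment s Y)"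
      using B unfolding barrier_on_def by (elim conjE)
    ultimately obtain s where s: "s \<in> B" "proper_initial_segment s Z"
      using Z(1) by metis
    then obtain m where "s = Z \<inter> {..<m}" using proper_initial_segment_iff[OF Z(1)] by metis
    then have "s \<subseteq> Z" by simp
    then show ?thesis using s by metis
  qed
  \<comment> \<open>As \<open>\<Union>B\<close> is infinite, \<open>B\<close> has a nonempty member,
    which would strictly contain \<open>{}\<close>.\<close>
  have nonempty: "s \<noteq> {}" if "s \<in> B" for s
  proof
    assume "s = {}"
    moreover have "\<Union>B \<noteq> {}" using B infinite_imp_nonempty by (auto simp: barrier_on_def)
    then obtain t where "t \<in> B" "t \<noteq> {}" by blast
    ultimately show False using B that by (auto simp: barrier_on_def)
  qed
  have "y \<in> \<Union>{s \<in> B. s \<subseteq> Y}" if "y \<in> Y" for y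
  proof -
    \<comment> \<open>\<open>?Z\<close> starts with \<open>y\<close>, so every nonempty initial
      segment of it contains \<open>y\<close>; hence the base is all of \<open>Y\<close>.\<close>
    let ?Z = "{y} \<union> tail {y} Y"
    have Z: "infinite ?Z" "?Z \<subseteq> Y"
      using infinite_tail[of "{y}" Y] Y that by (auto simp: tail_def)
    then obtain s where s: "s \<in> B" "s \<subseteq> ?Z" "proper_initial_segment s ?Z"
      using seg by blast
    then obtain m where m: "s = ?Z \<inter> {..<m}" using Z proper_initial_segment_iff by blast
    obtain x where "x \<in> s" using nonempty s(1) by blast
    then have "y \<in> s" unfolding m by (auto simp: tail_def)
    then show ?thesis using s Z by blast
  qed
  then have "\<Union>{s \<in> B. s \<subseteq> Y} = Y" by blast
  moreover have "\<exists>s\<in>{s \<in> B. s \<subseteq> Y}. proper_initial_segment s Z"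
    if Z: "infinite Z" "Z \<subseteq> Y" for Z
  proof -
    obtain s where s: "s \<in> B" "s \<subseteq> Z" "proper_initial_segment s Z" using seg[OF Z] by metis
    then have "s \<in> {s \<in> B. s \<subseteq> Y}" using Z(2) by simp
    then show ?thesis using s(3) by (rule rev_bexI)
  qed
  moreover have "\<forall>s\<in>B. finite s" "\<forall>s\<in>B. \<forall>t\<in>B. \<not> s \<subset> t"
    using B by (simp_all add: barrier_on_def)
  ultimately show ?thesis
    using Y(2) by (simp add: barrier_on_def)
qed

theorem mainTheorem2:
  fixes B :: "nat set set" and X :: "nat set" and f :: "nat set \<Rightarrow> nat"
  assumes "infinite X" and "barrier_on B X"
  shows "\<exists>B'. B' \<subseteq> B \<and> barrier B' \<and> f ` B' \<noteq> UNIV"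
proof -
  have "finite s" "\<not> s \<subset> t" if "s \<in> B" "t \<in> B" for s t
    using assms(2) that by (simp_all add: barrier_on_def)
  \<comment> \<open>The partition is into the fibre of \<open>f\<close> over 0 and its
    complement.\<close>
  then have "\<exists>Y\<subseteq>X. infinite Y \<and>
      ((\<forall>s\<in>B. s \<subseteq> Y \<longrightarrow> s \<in> {s \<in> B. f s = 0}) \<or> (\<forall>s\<in>B. s \<subseteq> Y \<longrightarrow> s \<notin> {s \<in> B. f s = 0}))"
    by (intro nash_williams[OF assms(1)]) auto
  then obtain Y where Y: "Y \<subseteq> X" "infinite Y"
    and hom: "(\<forall>s\<in>B. s \<subseteq> Y \<longrightarrow> f s = 0) \<or> (\<forall>s\<in>B. s \<subseteq> Y \<longrightarrow> f s \<noteq> 0)"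
    by auto
  let ?B = "{s \<in> B. s \<subseteq> Y}"
  have bar: "barrier_on ?B Y" by (rule barrier_on_restrict[OF assms(2) Y])
  then have "base ?B = Y" by (simp add: base_def barrier_on_def)
  then have "barrier ?B" using bar by (simp add: barrier_def)
  \<comment> \<open>If \<open>f\<close> is constantly 0 on \<open>?B\<close>, the value 1 is missed;
    otherwise 0 is.\<close>
  moreover have "1 \<notin> f ` ?B \<or> 0 \<notin> f ` ?B" using hom by force
  then have "f ` ?B \<noteq> UNIV" by blast
  ultimately show ?thesis by (intro exI[of _ ?B]) simp
qed

end
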